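(* Let $G=(V,E)$ be a graph, let $C\subseteq V$ induce an odd cycle in $G$, and let $k\in V$ with $k\notin C$. Then every $X=(X_{ij})_{i,j\in C\cup\{k\}}\in\mathrm{COL}(G_{C\cup\{k\}})$ satisfies $$\sum_{i\in C}X_{ik}\le\tfrac12(|C|-1).$$
   Context: Graphs are finite, simple and undirected. For $I\subseteq V$, $G_I$ is the subgraph of $G$ induced by $I$. A cycle is a sequence of distinct vertices $i_1,\dots,i_r$ ($r\ge3$) such that consecutive vertices are adjacent and $i_r$ is adjacent to $i_1$; it may have chords (further edges between its vertices). An odd cycle is a cycle with an odd number of vertices. A set $C$ induces an odd cycle in $G$ if $C$ is the vertex set of an odd cycle in $G$. For a graph $H$, a coloring matrix of $H$ is a matrix $\sum_{p=1}^{\ell}s_ps_p^\top$, where $s_1,\dots,s_\ell\in\{0,1\}^{V(H)}$ are the incidence vectors of the (nonempty) classes of a partition of $V(H)$ into stable sets of $H$ (for some $\ell$); $\mathrm{COL}(H)$ is the convex hull of all coloring matrices of $H$. *)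

theory Defs
  imports
    "HOL-Analysis.Analysis"
    "HOL-Library.Disjoint_Sets"
    "Graph_Theory.Digraph_Component"
begin

text \<open>
  An undirected edge is represented by the pair of opposite arcs of the
  symmetric digraphs of locale \<open>graph\<close>.  The library predicate
  \<open>pre_digraph.cycle\<close> also admits the closed walk \<open>u, v, u\<close>, hence the separate
  notion of a cycle as a sequence of at least three distinct vertices.
\<close>

definition vertex_cycle :: "('v, 'e) pre_digraph \<Rightarrow> 'v list \<Rightarrow> bool" where
  "vertex_cycle G vs \<longleftrightarrow>
     3 \<le> length vs \<and> distinct vs \<and> set vs \<subseteq> verts G \<and>
     (\<forall>j. Suc j < length vs \<longrightarrow> vs ! j \<rightarrow>\<^bsub>G\<^esub> vs ! Suc j) \<and>
     last vs \<rightarrow>\<^bsub>G\<^esub> hd vs"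

definition induces_odd_cycle :: "('v, 'e) pre_digraph \<Rightarrow> 'v set \<Rightarrow> bool" where
  "induces_odd_cycle G C \<longleftrightarrow>
     (\<exists>vs. vertex_cycle G vs \<and> odd (length vs) \<and> C = set vs)"

definition stable_set :: "('v, 'e) pre_digraph \<Rightarrow> 'v set \<Rightarrow> bool" where
  "stable_set H S \<longleftrightarrow> S \<subseteq> verts H \<and> (\<forall>u\<in>S. \<forall>v\<in>S. \<not> u \<rightarrow>\<^bsub>H\<^esub> v)"

text \<open>
  Vectors and matrices over \<open>verts H\<close> are indexed by the whole finite vertex type
  \<open>'v\<close>.  Incidence vectors of subsets of \<open>verts H\<close> vanish outside \<open>verts H\<close>, so
  \<open>COL H\<close> below consists of the matrices over \<open>verts H\<close>, extended by zero.
\<close>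

definition incidence_vector :: "'v set \<Rightarrow> real ^ 'v" where
  "incidence_vector S = (\<chi> i. indicator S i)"

definition outer_product :: "real ^ 'v \<Rightarrow> real ^ 'v \<Rightarrow> real ^ 'v ^ 'v" where
  "outer_product s t = (\<chi> i j. s $ i * t $ j)"

definition coloring_matrices :: "('v::finite, 'e) pre_digraph \<Rightarrow> (real ^ 'v ^ 'v) set" where
  "coloring_matrices H =
     {\<Sum>S\<in>P. outer_product (incidence_vector S) (incidence_vector S) | P.
        partition_on (verts H) P \<and> (\<forall>S\<in>P. stable_set H S)}"

definition COL :: "('v::finite, 'e) pre_digraph \<Rightarrow> (real ^ 'v ^ 'v) set" where
  "COL H = convex hull (coloring_matrices H)"

end

theory Submission
  imports Defs
begin

text \<open>
  The inequality is linear in \<open>X\<close>, so it cuts out a half-space, and it suffices to verify it on the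
  coloring matrices whose convex hull is \<open>COL\<close>.  In a coloring matrix the column of \<open>k\<close> is the
  incidence vector of the class \<open>S\<close> containing \<open>k\<close>, so the left-hand side counts \<open>S \<inter> C\<close>.  Moving
  one step along the cycle maps \<open>S \<inter> C\<close> injectively into \<open>C - S\<close>, because \<open>S\<close> is stable
  (\<open>stable_set_at_most_half_cycle\<close>).  Hence \<open>S \<inter> C\<close> has at most half the vertices of \<open>C\<close>, and, as
  \<open>card C\<close> is odd, at most \<open>(card C - 1) / 2\<close> of them.
\<close>

lemma dominates_induce_subgraph:
  assumes "u \<rightarrow>\<^bsub>G\<^esub> v" "u \<in> W" "v \<in> W"
  shows "u \<rightarrow>\<^bsub>G \<restriction> W\<^esub> v"
  using assms by (force simp: arcs_ends_def arc_to_ends_def)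

lemma vertex_cycle_induce_subgraph:
  assumes "vertex_cycle G vs" "set vs \<subseteq> W"
  shows "vertex_cycle (G \<restriction> W) vs"
proof -
  have "vs \<noteq> []" using assms(1) by (auto simp: vertex_cycle_def)
  moreover have "vs ! j \<in> W" if "j < length vs" for j
    using assms(2) that by (meson nth_mem subsetD)
  ultimately show ?thesis
    using assms unfolding vertex_cycle_def
    by (auto intro!: dominates_induce_subgraph)
qed

text \<open>
  The cyclic successor of a position in \<open>S\<close> is a position outside \<open>S\<close>, so the positions in \<open>S\<close> and
  their successors are disjoint sets of the same size.
\<close>

lemma stable_set_at_most_half_cycle:
  assumes cyc: "vertex_cycle G vs" and stab: "stable_set G S"
  shows "2 * card (S \<inter> set vs) \<le> length vs"
proof -
  define n where "n = length vs"
  define A where "A = {j. j < n \<and> vs ! j \<in> S}"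
  let ?next = "\<lambda>j. Suc j mod n"
  have n: "3 \<le> n" and dist: "distinct vs"
    using cyc by (auto simp: vertex_cycle_def n_def)
  have arc: "vs ! j \<rightarrow>\<^bsub>G\<^esub> vs ! ?next j" if "j < n" for j
  proof (cases "Suc j = n")
    case True
    have "vs \<noteq> []" using n by (auto simp: n_def)
    moreover have "j = length vs - 1" "?next j = 0" using True by (simp_all add: n_def)
    ultimately have "vs ! j = last vs" "vs ! ?next j = hd vs"
      by (metis last_conv_nth, metis hd_conv_nth)
    then show ?thesis using cyc by (simp add: vertex_cycle_def)
  next
    case False
    then show ?thesis using cyc that by (simp add: vertex_cycle_def n_def)
  qed
  have "?next ` A \<inter> A = {}"
    using arc stab by (fastforce simp: A_def stable_set_def)
  moreover have "inj_on ?next A"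
    by (auto simp: inj_on_def A_def mod_Suc split: if_splits)
  moreover have "?next ` A \<union> A \<subseteq> {..<n}"
    using n by (auto simp: A_def)
  moreover have "finite A" by (simp add: A_def)
  ultimately have "2 * card A \<le> n"
    using card_mono[of "{..<n}" "?next ` A \<union> A"]
    by (simp add: card_Un_disjoint card_image)
  moreover have "S \<inter> set vs = (!) vs ` A"
    by (auto simp: A_def n_def in_set_conv_nth)
  moreover have "inj_on ((!) vs) A"
    using dist by (auto simp: A_def n_def inj_on_def nth_eq_iff_index_eq)
  ultimately show ?thesis by (simp add: card_image n_def)
qed

corollary stable_set_odd_cycle_bound:
  assumes "induces_odd_cycle G C" "stable_set G S"
  shows "real (card (S \<inter> C)) \<le> 1 / 2 * (real (card C) - 1)"
proof -
  obtain vs where vs: "vertex_cycle G vs" "odd (length vs)" "C = set vs"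
    using assms(1) by (auto simp: induces_odd_cycle_def)
  then have "card C = length vs"
    by (simp add: vertex_cycle_def distinct_card)
  with stable_set_at_most_half_cycle[OF vs(1) assms(2)] vs(2,3)
  have "2 * card (S \<inter> C) + 1 \<le> card C"
    by (metis Suc_eq_plus1 Suc_leI dvd_triv_left le_neq_implies_less)
  then have "real (2 * card (S \<inter> C) + 1) \<le> real (card C)"
    by (rule of_nat_mono)
  then show ?thesis by simp
qed

text \<open>
  The classes of a coloring are disjoint, so only the class of \<open>k\<close> contributes to column \<open>k\<close>.
\<close>

lemma coloring_matrix_column_sum:
  fixes H :: "('v::finite, 'e) pre_digraph"
  assumes "X \<in> coloring_matrices H" "k \<in> verts H"
  obtains S where "stable_set H S" "\<And>C. (\<Sum>i\<in>C. X $ i $ k) = real (card (S \<inter> C))"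
proof -
  obtain P where part: "partition_on (verts H) P" and stab: "\<forall>S\<in>P. stable_set H S"
    and X: "X = (\<Sum>S\<in>P. outer_product (incidence_vector S) (incidence_vector S))"
    using assms(1) by (auto simp: coloring_matrices_def)
  obtain S where S: "S \<in> P" "k \<in> S"
    using part assms(2) by (auto simp: partition_on_def)
  have entry: "X $ i $ k = indicator S i" for i
  proof -
    have "X $ i $ k = (\<Sum>T\<in>P. indicator T i * indicator T k)"
      by (simp add: X outer_product_def incidence_vector_def)
    also have "\<dots> = (\<Sum>T\<in>{S}. indicator T i * indicator T k)"
    proof (rule sum.mono_neutral_right)
      show "\<forall>T\<in>P - {S}. indicator T i * indicator T k = (0::real)"
        using part S by (auto simp: partition_on_def disjoint_def indicator_def)
    qed (use S in auto)
    finally show ?thesis using S by simp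
  qed
  have "(\<Sum>i\<in>C. X $ i $ k) = real (card (S \<inter> C))" for C
    by (simp add: entry indicator_def Int_commute flip: sum.inter_restrict)
  then show ?thesis using that S stab by blast
qed

lemma convex_column_sum_le:
  "convex {X :: real ^ 'n::finite ^ 'm::finite. (\<Sum>i\<in>C. X $ i $ k) \<le> b}"
proof -
  have "linear (\<lambda>X :: real ^ 'n ^ 'm. \<Sum>i\<in>C. X $ i $ k)"
    by (rule linearI) (simp_all add: sum.distrib sum_distrib_left)
  from convex_linear_vimage[OF this, of "{..b}"] show ?thesis
    by (simp add: vimage_def)
qed

theorem lemma20:
  fixes G :: "('v::finite, 'e) pre_digraph"
    and C :: "'v set" and k :: 'v
    and X :: "real ^ 'v ^ 'v"
  assumes "graph G"
    and "C \<subseteq> verts G" and "induces_odd_cycle G C"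
    and "k \<in> verts G" and "k \<notin> C"
    and "X \<in> COL (G \<restriction> (C \<union> {k}))"
  shows "(\<Sum>i\<in>C. X $ i $ k) \<le> 1 / 2 * (real (card C) - 1)"
proof -
  let ?H = "G \<restriction> (C \<union> {k})"
  let ?B = "{X. (\<Sum>i\<in>C. X $ i $ k) \<le> 1 / 2 * (real (card C) - 1)}"
  have cycle: "induces_odd_cycle ?H C"
    using assms(3) unfolding induces_odd_cycle_def
    by (metis Un_upper1 vertex_cycle_induce_subgraph)
  have "coloring_matrices ?H \<subseteq> ?B"
  proof
    fix Y assume "Y \<in> coloring_matrices ?H"
    then obtain S where "stable_set ?H S" "(\<Sum>i\<in>C. Y $ i $ k) = real (card (S \<inter> C))"
      by (rule coloring_matrix_column_sum[where k = k]) auto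
    then show "Y \<in> ?B"
      using stable_set_odd_cycle_bound[OF cycle] by simp
  qed
  then have "COL ?H \<subseteq> ?B"
    unfolding COL_def by (intro hull_minimal convex_column_sum_le)
  with assms(6) show ?thesis by blast
qed

end
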